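(* For linear continuous interpolation, if $u\in C^3(D)$ and $u_{xxx}$ is bounded on $D$, then for the linearized peridynamic force $$\sup_{i\in K}\big|\nabla PD_l^\epsilon(\mathcal{I}_h[u])(x_i)-\nabla PD_l^\epsilon(u)(x_i)\big|=O(h/\epsilon),$$ and for the nonlinear peridynamic force $$\sup_{i\in K}\big|\nabla PD^\epsilon(\mathcal{I}_h[u])(x_i)-\nabla PD^\epsilon(u)(x_i)\big|=O(h/\epsilon).$$ Here $O(h/\epsilon)$ means bounded by $C h/\epsilon$ with $C$ independent of $h$, $\epsilon$ and $i$.
   Context: $D=[a,b]\subset\mathbb{R}$ is a bounded interval, $\epsilon>0$ is the horizon, and $\partial D^\epsilon=(a-\epsilon,a+\epsilon)\cup(b-\epsilon,b+\epsilon)$ is the nonlocal boundary. $C^n(D)$ is the space of functions with $n$ continuous derivatives on $D$. In this setting, nonlocal displacements have zero boundary values on $\partial D^\epsilon$, and the local elastodynamic displacement is extended by zero outside $D$. The strain is $S(y,x;u)=\frac{u(y)-u(x)}{|y-x|}$. The function $f:[0,\infty)\to\mathbb{R}$ is positive (for $r>0$), smooth and concave with $\lim_{r\to0^+}f(r)/r=f'(0)$ and $\lim_{r\to\infty}f(r)=f_\infty<\infty$, and $f'',f''',f''''$ are bounded on $(0,\infty)$. The influence function $J(|\xi|)$ is zero for $\xi$ outside $[-1,1]$ and satisfies $0\le J(|\xi|)\le M$ on $[-1,1]$. The nonlinear and linearized peridynamic forces are $$-\nabla PD^\epsilon(u)(x)=\frac{2}{\epsilon^2}\int_{x-\epsilon}^{x+\epsilon}J(|y-x|/\epsilon)f'\big(|y-x|S(y,x;u)^2\big)S(y,x;u)\,dy,$$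 $$-\nabla PD_l^\epsilon(u)(x)=\frac{2}{\epsilon^2}\int_{x-\epsilon}^{x+\epsilon}J(|y-x|/\epsilon)f'(0)S(y,x;u)\,dy .$$ Mesh: $h>0$ is the mesh size, $x_i=ih$, $K=\{i\in\mathbb{Z}:ih\in\overline D\}$, $K_\epsilon=\{i\in\mathbb{Z}:ih\in\overline{\partial D^\epsilon}\}$; $\overline D$ and $\overline{\partial D^\epsilon}$ contain an integral number of mesh elements and $\epsilon=mh$ with $m$ a positive integer. For a function $g:\overline{D\cup\partial D^\epsilon}\to\mathbb{R}$ the interpolation operator is $\mathcal{I}_h[g](y)=\sum_{i\in K\cup K_\epsilon}g(x_i)\phi_i(y)$, where $\phi_i$ is the piecewise linear hat function: $\phi_i=0$ outside $[x_{i-1},x_{i+1}]$, $\phi_i(x)=(x-x_{i-1})/h$ on $[x_{i-1},x_i]$, $\phi_i(x)=(x_{i+1}-x)/h$ on $[x_i,x_{i+1}]$. *)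

theory Defs
  imports "HOL-Analysis.Analysis"
begin

(* Derivatives are taken relative to S, hence one-sided at boundary points belonging to S. *)
fun nth_deriv_on :: "real set \<Rightarrow> nat \<Rightarrow> (real \<Rightarrow> real) \<Rightarrow> real \<Rightarrow> real" where
  "nth_deriv_on S 0 g = g"
| "nth_deriv_on S (Suc n) g = (\<lambda>x. vector_derivative (nth_deriv_on S n g) (at x within S))"

definition Cn_on :: "nat \<Rightarrow> real set \<Rightarrow> (real \<Rightarrow> real) \<Rightarrow> bool" where
  "Cn_on n S g \<longleftrightarrow>
     (\<forall>k<n. nth_deriv_on S k g differentiable_on S) \<and> continuous_on S (nth_deriv_on S n g)"

definition smooth_on :: "real set \<Rightarrow> (real \<Rightarrow> real) \<Rightarrow> bool" where
  "smooth_on S g \<longleftrightarrow> (\<forall>n. Cn_on n S g)"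

definition nonlocal_boundary :: "real \<Rightarrow> real \<Rightarrow> real \<Rightarrow> real set" where
  "nonlocal_boundary a b \<epsilon> = {a - \<epsilon><..<a + \<epsilon>} \<union> {b - \<epsilon><..<b + \<epsilon>}"

definition strain :: "real \<Rightarrow> real \<Rightarrow> (real \<Rightarrow> real) \<Rightarrow> real" where
  "strain y x u = (u y - u x) / \<bar>y - x\<bar>"

(* grad_PD and grad_PD_lin are the operators written with a nabla;
   the peridynamic forces are their negatives, hence the leading minus sign. *)
definition grad_PD ::
  "(real \<Rightarrow> real) \<Rightarrow> (real \<Rightarrow> real) \<Rightarrow> real \<Rightarrow> (real \<Rightarrow> real) \<Rightarrow> real \<Rightarrow> real" where
  "grad_PD J f \<epsilon> u x =
     - (2 / \<epsilon>\<^sup>2 * (LINT y:{x - \<epsilon>..x + \<epsilon>}|lebesgue.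
          J (\<bar>y - x\<bar> / \<epsilon>) * nth_deriv_on {0..} 1 f (\<bar>y - x\<bar> * (strain y x u)\<^sup>2) * strain y x u))"

definition grad_PD_lin ::
  "(real \<Rightarrow> real) \<Rightarrow> (real \<Rightarrow> real) \<Rightarrow> real \<Rightarrow> (real \<Rightarrow> real) \<Rightarrow> real \<Rightarrow> real" where
  "grad_PD_lin J f \<epsilon> u x =
     - (2 / \<epsilon>\<^sup>2 * (LINT y:{x - \<epsilon>..x + \<epsilon>}|lebesgue.
          J (\<bar>y - x\<bar> / \<epsilon>) * nth_deriv_on {0..} 1 f 0 * strain y x u))"

definition node :: "real \<Rightarrow> int \<Rightarrow> real" where
  "node h i = of_int i * h"

definition nodes_in :: "real \<Rightarrow> real set \<Rightarrow> int set" where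
  "nodes_in h A = {i. node h i \<in> closure A}"

(* The closure of A is a finite union of mesh elements [x_i, x_(i+1)]. *)
definition meshed :: "real \<Rightarrow> real set \<Rightarrow> bool" where
  "meshed h A \<longleftrightarrow> (\<exists>I. finite I \<and> closure A = (\<Union>i\<in>I. {node h i..node h (i + 1)}))"

definition admissible_mesh :: "real \<Rightarrow> real \<Rightarrow> real \<Rightarrow> real \<Rightarrow> bool" where
  "admissible_mesh a b \<epsilon> h \<longleftrightarrow>
     h > 0 \<and> \<epsilon> > 0 \<and> (\<exists>m::nat. m > 0 \<and> \<epsilon> = of_nat m * h) \<and>
     meshed h {a..b} \<and> meshed h (nonlocal_boundary a b \<epsilon>)"

definition hat :: "real \<Rightarrow> int \<Rightarrow> real \<Rightarrow> real" where
  "hat h i y =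
     (if y \<in> {node h (i - 1)..node h i} then (y - node h (i - 1)) / h
      else if y \<in> {node h i..node h (i + 1)} then (node h (i + 1) - y) / h
      else 0)"

definition interp :: "real \<Rightarrow> real \<Rightarrow> real \<Rightarrow> real \<Rightarrow> (real \<Rightarrow> real) \<Rightarrow> real \<Rightarrow> real" where
  "interp a b \<epsilon> h g y =
     (\<Sum>i\<in>nodes_in h {a..b} \<union> nodes_in h (nonlocal_boundary a b \<epsilon>). g (node h i) * hat h i y)"

end

theory Submission
  imports Defs
begin

text \<open>
  Since interpolation reproduces the values at the nodes, the strains of \<open>u\<close> and of its interpolant
  \<open>v\<close> at a node \<open>x\<close> differ by \<open>(v y - u y) / \<bar>y - x\<bar>\<close>. The usual bound \<open>\<bar>v y - u y\<bar> \<le> L h\<^sup>2\<close> alone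
  does not control this quotient near \<open>x\<close>. But the error vanishes at every node and grows away from a
  node with slope at most \<open>L h\<close>, so in fact \<open>\<bar>v y - u y\<bar> \<le> L h \<bar>y - x\<bar>\<close> for \<^emph>\<open>every\<close> node \<open>x\<close>
  (\<open>interp_error\<close>). Here \<open>L\<close> bounds \<open>u''\<close> on \<open>D\<close>. The extension by zero has kinks at the
  endpoints of \<open>D\<close>, but these are nodes, so no mesh element sees a kink. Hence the two strains differ
  by at most \<open>L h\<close>, uniformly in \<open>y\<close>.

  The force density depends on the strain \<open>S\<close> over a bond of length \<open>r\<close> through \<open>g (r S\<^sup>2) S\<close>, where
  \<open>g = f'\<close> in the nonlinear case and \<open>g\<close> is the constant \<open>f' 0\<close> in the linear case. Both are Lipschitz, as \<open>f''\<close> is bounded.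
  As \<open>\<epsilon>\<close> may be arbitrarily large, so may \<open>r\<close>; what stays bounded besides \<open>S\<close> is \<open>r \<bar>S\<bar>\<close>, the
  difference of two values of the displacement. These two bounds make the density Lipschitz in \<open>S\<close> with a
  constant independent of the bond (\<open>bond_force_lipschitz\<close>). So the integrands differ by \<open>O(h)\<close>;
  integrating over an interval of length \<open>2 \<epsilon>\<close> and multiplying by \<open>2 / \<epsilon>\<^sup>2\<close> yields \<open>O(h / \<epsilon>)\<close>.
\<close>

section \<open>Derivatives relative to a set\<close>

lemma nth_deriv_on_has_derivative:
  assumes "Cn_on n S g" "k < n" "x \<in> S"
  shows "(nth_deriv_on S k g has_real_derivative nth_deriv_on S (Suc k) g x) (at x within S)"
proof -
  have "nth_deriv_on S k g differentiable (at x within S)"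
    using assms by (auto simp: Cn_on_def differentiable_on_def)
  then show ?thesis
    by (simp add: has_real_derivative_iff_has_vector_derivative vector_derivative_works)
qed

lemma nth_deriv_on_lipschitz:
  assumes "Cn_on n S g" "k < n" "convex S"
    and "\<And>x. x \<in> S \<Longrightarrow> \<bar>nth_deriv_on S (Suc k) g x\<bar> \<le> L"
    and "x \<in> S" "y \<in> S"
  shows "\<bar>nth_deriv_on S k g x - nth_deriv_on S k g y\<bar> \<le> L * \<bar>x - y\<bar>"
proof -
  have "norm (nth_deriv_on S k g x - nth_deriv_on S k g y) \<le> L * norm (x - y)"
    by (rule field_differentiable_bound[OF \<open>convex S\<close>])
       (use assms nth_deriv_on_has_derivative in auto)
  then show ?thesis by simp
qed

lemma nth_deriv_on_bounded:
  assumes "Cn_on n {a..b} g" "k \<le> n"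
  obtains B where "B \<ge> 0" "\<And>x. x \<in> {a..b} \<Longrightarrow> \<bar>nth_deriv_on {a..b} k g x\<bar> \<le> B"
proof -
  have "continuous_on {a..b} (nth_deriv_on {a..b} k g)"
    using assms by (cases "k = n") (auto simp: Cn_on_def differentiable_imp_continuous_on)
  then have "bounded (nth_deriv_on {a..b} k g ` {a..b})"
    by (intro compact_imp_bounded compact_continuous_image) auto
  then obtain B where "0 < B" "\<forall>x\<in>{a..b}. \<bar>nth_deriv_on {a..b} k g x\<bar> \<le> B"
    by (auto simp: bounded_pos)
  then show ?thesis using that[of B] by simp
qed

lemma mean_value_slope:
  fixes u u' :: "real \<Rightarrow> real"
  assumes "s < t" and "{s..t} \<subseteq> S"
    and "\<And>x. x \<in> S \<Longrightarrow> (u has_real_derivative u' x) (at x within S)"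
  obtains \<xi> where "\<xi> \<in> {s..t}" "u t - u s = u' \<xi> * (t - s)"
proof -
  have "\<exists>x\<in>{s<..<t}. u t - u s = (*) (u' x) (t - s)"
  proof (rule mvt_simple[OF \<open>s < t\<close>])
    fix x assume "s \<le> x" "x \<le> t"
    then show "(u has_derivative (*) (u' x)) (at x within {s..t})"
      using assms has_field_derivative_subset[of u "u' x" x S "{s..t}"]
      by (auto simp: has_field_derivative_def)
  qed
  then obtain \<xi> where "\<xi> \<in> {s<..<t}" "u t - u s = u' \<xi> * (t - s)" by blast
  then show ?thesis using that[of \<xi>] by simp
qed

section \<open>Error of piecewise linear interpolation\<close>

text \<open>The chord has slope \<open>u' \<xi>\<close>, and the chord of \<open>u\<close> from either end of the element to \<open>y\<close> has slope
  \<open>u' \<eta>\<close>, with both points in \<open>{s..t}\<close>. So the error is the difference of the two slopes times the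
  distance of \<open>y\<close> from that end. Keeping this distance, rather than bounding it by \<open>t - s\<close>, is what
  controls the strain near a node.\<close>

lemma linear_interpolation_error:
  fixes u u' :: "real \<Rightarrow> real"
  assumes "s < t" and "{s..t} \<subseteq> S"
    and der: "\<And>x. x \<in> S \<Longrightarrow> (u has_real_derivative u' x) (at x within S)"
    and lip: "\<And>x y. x \<in> S \<Longrightarrow> y \<in> S \<Longrightarrow> \<bar>u' x - u' y\<bar> \<le> L * \<bar>x - y\<bar>"
    and "L \<ge> 0" and y: "y \<in> {s..t}"
  defines "e \<equiv> u s + (u t - u s) * (y - s) / (t - s) - u y"
  shows "\<bar>e\<bar> \<le> L * (t - s) * (y - s)" and "\<bar>e\<bar> \<le> L * (t - s) * (t - y)"
proof -
  obtain \<xi> where \<xi>: "\<xi> \<in> {s..t}" "u t - u s = u' \<xi> * (t - s)"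
    using mean_value_slope[of s t S u u'] assms(1,2) der by blast
  have slopes: "\<bar>u' \<xi> - u' \<eta>\<bar> \<le> L * (t - s)" if "\<eta> \<in> {s..t}" for \<eta>
  proof -
    have "\<bar>u' \<xi> - u' \<eta>\<bar> \<le> L * \<bar>\<xi> - \<eta>\<bar>" using lip that \<xi>(1) assms(2) by blast
    also have "\<dots> \<le> L * (t - s)" using that \<xi>(1) \<open>L \<ge> 0\<close> by (intro mult_left_mono) auto
    finally show ?thesis .
  qed
  have e_left: "e = u' \<xi> * (y - s) - (u y - u s)"
    unfolding e_def \<xi>(2) using \<open>s < t\<close> by simp
  have e_right: "e = (u t - u y) - u' \<xi> * (t - y)"
    using e_left \<xi>(2) by (simp add: algebra_simps)
  show "\<bar>e\<bar> \<le> L * (t - s) * (y - s)"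
  proof (cases "y = s")
    case True then show ?thesis using e_left by simp
  next
    case False
    then have "s < y" "{s..y} \<subseteq> S" using y assms(2) by auto
    then obtain \<eta> where \<eta>: "\<eta> \<in> {s..y}" "u y - u s = u' \<eta> * (y - s)"
      using mean_value_slope[of s y S u u'] der by blast
    have "\<bar>e\<bar> = \<bar>u' \<xi> - u' \<eta>\<bar> * (y - s)"
      unfolding e_left \<eta>(2) using y by (simp add: left_diff_distrib[symmetric] abs_mult)
    also have "\<dots> \<le> L * (t - s) * (y - s)"
      using slopes[of \<eta>] \<eta>(1) y by (intro mult_right_mono) auto
    finally show ?thesis .
  qed
  show "\<bar>e\<bar> \<le> L * (t - s) * (t - y)"
  proof (cases "y = t")
    case True then show ?thesis using e_right by simp
  next
    case False
    then have "y < t" "{y..t} \<subseteq> S" using y assms(2) by auto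
    then obtain \<eta> where \<eta>: "\<eta> \<in> {y..t}" "u t - u y = u' \<eta> * (t - y)"
      using mean_value_slope[of y t S u u'] der by blast
    have "\<bar>e\<bar> = \<bar>u' \<xi> - u' \<eta>\<bar> * (t - y)"
      unfolding e_right \<eta>(2) using y
      by (simp add: left_diff_distrib[symmetric] abs_mult abs_minus_commute)
    also have "\<dots> \<le> L * (t - s) * (t - y)"
      using slopes[of \<eta>] \<eta>(1) y by (intro mult_right_mono) auto
    finally show ?thesis .
  qed
qed

lemma node_Suc: "node h (i + 1) = node h i + h"
  by (simp add: node_def algebra_simps)

lemma node_le_iff: "h > 0 \<Longrightarrow> node h i \<le> node h j \<longleftrightarrow> i \<le> j"
  by (simp add: node_def)

lemma mesh_element:
  assumes "h > 0"
  obtains j where "y \<in> {node h j..node h (j + 1)}"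
proof -
  have "of_int \<lfloor>y / h\<rfloor> \<le> y / h" "y / h < of_int \<lfloor>y / h\<rfloor> + 1" by linarith+
  then have "y \<in> {node h \<lfloor>y / h\<rfloor>..node h (\<lfloor>y / h\<rfloor> + 1)}"
    using assms unfolding node_def of_int_add of_int_1
    by (metis atLeastAtMost_iff less_imp_le pos_divide_less_eq pos_le_divide_eq)
  then show ?thesis using that by blast
qed

lemma hat_eq_0:
  assumes "h > 0" "y \<in> {node h j..node h (j + 1)}" "i \<noteq> j" "i \<noteq> j + 1"
  shows "hat h i y = 0"
proof (cases "i < j")
  case True
  then have "node h (i + 1) \<le> node h j" using node_le_iff[OF \<open>h > 0\<close>] by simp
  then show ?thesis using assms node_Suc[of h i] by (auto simp: hat_def)
next
  case False
  then have "node h (j + 1) \<le> node h (i - 1)" using assms node_le_iff[OF \<open>h > 0\<close>] by simp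
  then show ?thesis using assms node_Suc[of h "i - 1"] by (auto simp: hat_def)
qed

lemma hat_left:
  assumes "h > 0" "y \<in> {node h j..node h (j + 1)}"
  shows "hat h j y = 1 - (y - node h j) / h"
proof (cases "y = node h j")
  case True
  then show ?thesis using \<open>h > 0\<close> node_Suc[of h "j - 1"] by (simp add: hat_def)
next
  case False
  then show ?thesis using assms by (simp add: hat_def node_Suc diff_divide_distrib add_divide_distrib)
qed

lemma hat_right:
  assumes "h > 0" "y \<in> {node h j..node h (j + 1)}"
  shows "hat h (j + 1) y = (y - node h j) / h"
  using assms by (auto simp: hat_def)

text \<open>The index set \<open>N\<close> may miss one or both ends of the element, as happens for elements outside the
  meshed region. The missing indices contribute nothing because \<open>g\<close> vanishes there.\<close>

lemma hat_sum_on_element: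
  assumes "h > 0" "y \<in> {node h j..node h (j + 1)}"
    and "finite N" and off: "\<And>i. i \<notin> N \<Longrightarrow> g (node h i) = 0"
  shows "(\<Sum>i\<in>N. g (node h i) * hat h i y)
       = g (node h j) + (g (node h (j + 1)) - g (node h j)) * (y - node h j) / h"
proof -
  have "(\<Sum>i\<in>N. g (node h i) * hat h i y) = (\<Sum>i\<in>N \<union> {j, j + 1}. g (node h i) * hat h i y)"
    using \<open>finite N\<close> off by (intro sum.mono_neutral_left) auto
  also have "\<dots> = (\<Sum>i\<in>{j, j + 1}. g (node h i) * hat h i y)"
    using \<open>finite N\<close> hat_eq_0[OF assms(1,2)] by (intro sum.mono_neutral_right) auto
  also have "\<dots> = g (node h j) * (1 - (y - node h j) / h) + g (node h (j + 1)) * ((y - node h j) / h)"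
    using hat_left[OF assms(1,2)] hat_right[OF assms(1,2)] by simp
  finally show ?thesis by (simp add: algebra_simps add_divide_distrib diff_divide_distrib)
qed

lemma finite_nodes_in:
  assumes "h > 0" "bounded A"
  shows "finite (nodes_in h A)"
proof -
  obtain B where B: "\<And>x. x \<in> closure A \<Longrightarrow> \<bar>x\<bar> \<le> B"
    using bounded_closure[OF \<open>bounded A\<close>] by (auto simp: bounded_iff)
  have "nodes_in h A \<subseteq> {\<lfloor>- B / h\<rfloor>..\<lceil>B / h\<rceil>}"
  proof
    fix i assume "i \<in> nodes_in h A"
    then have "\<bar>of_int i * h\<bar> \<le> B" using B by (auto simp: nodes_in_def node_def)
    then have "- B / h \<le> of_int i" "of_int i \<le> B / h"
      using \<open>h > 0\<close> by (auto simp: field_simps abs_le_iff)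
    then show "i \<in> {\<lfloor>- B / h\<rfloor>..\<lceil>B / h\<rceil>}" by (simp add: floor_le_iff le_ceiling_iff)
  qed
  then show ?thesis by (rule finite_subset) simp
qed

text \<open>An element that contains \<open>a\<close> lies in \<open>{a..b}\<close>, so its left end cannot be less than \<open>a\<close>;
  symmetrically for \<open>b\<close>.\<close>

lemma meshed_interval_endpoints:
  assumes "meshed h {a..b}" "a \<le> b" "h > 0"
  obtains A B where "a = node h A" "b = node h B"
proof -
  obtain I where I: "{a..b} = (\<Union>i\<in>I. {node h i..node h (i + 1)})"
    using assms(1) by (auto simp: meshed_def)
  have "a \<in> {a..b}" "b \<in> {a..b}" using \<open>a \<le> b\<close> by auto
  then obtain i j where ij: "i \<in> I" "a \<in> {node h i..node h (i + 1)}"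
      "j \<in> I" "b \<in> {node h j..node h (j + 1)}"
    unfolding I by blast
  have "{node h k..node h (k + 1)} \<subseteq> {a..b}" if "k \<in> I" for k
    unfolding I using that by blast
  moreover have "node h k \<in> {node h k..node h (k + 1)}" "node h (k + 1) \<in> {node h k..node h (k + 1)}" for k
    using \<open>h > 0\<close> by (simp_all add: node_Suc)
  ultimately have "node h i \<in> {a..b}" "node h (j + 1) \<in> {a..b}"
    using ij by blast+
  then have "a = node h i" "b = node h (j + 1)" using ij by auto
  then show ?thesis using that by blast
qed

text \<open>Each element lies inside \<open>{a..b}\<close>, where \<open>linear_interpolation_error\<close> applies, or outside it up to
  an endpoint, where \<open>u\<close> and its interpolant vanish. No node lies strictly inside the element of \<open>y\<close>, so
  the distance of \<open>y\<close> to any node is at least its distance to one of the two ends of the element: the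
  first bound therefore holds with an arbitrary node \<open>i\<close>.\<close>

lemma interp_error:
  fixes u u' :: "real \<Rightarrow> real"
  assumes mesh: "admissible_mesh a b \<epsilon> h" and "a < b"
    and der: "\<And>x. x \<in> {a..b} \<Longrightarrow> (u has_real_derivative u' x) (at x within {a..b})"
    and lip: "\<And>x y. x \<in> {a..b} \<Longrightarrow> y \<in> {a..b} \<Longrightarrow> \<bar>u' x - u' y\<bar> \<le> L * \<bar>x - y\<bar>"
    and "L \<ge> 0"
    and outside: "u a = 0" "u b = 0" "\<And>x. x \<notin> {a..b} \<Longrightarrow> u x = 0"
  shows "\<bar>interp a b \<epsilon> h u y - u y\<bar> \<le> L * h * \<bar>y - node h i\<bar>"
    and "\<bar>interp a b \<epsilon> h u y - u y\<bar> \<le> L * h * h"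
proof -
  have "h > 0" using mesh by (simp add: admissible_mesh_def)
  obtain j where j: "y \<in> {node h j..node h (j + 1)}" using mesh_element[OF \<open>h > 0\<close>] .
  obtain A B where AB: "a = node h A" "b = node h B"
    using meshed_interval_endpoints[of h a b] mesh \<open>a < b\<close> by (auto simp: admissible_mesh_def)
  define e where "e = interp a b \<epsilon> h u y - u y"
  let ?N = "nodes_in h {a..b} \<union> nodes_in h (nonlocal_boundary a b \<epsilon>)"
  have "finite ?N"
    using \<open>h > 0\<close> by (auto intro!: finite_nodes_in simp: nonlocal_boundary_def)
  moreover have "u (node h k) = 0" if "k \<notin> ?N" for k
    using that outside(3) by (auto simp: nodes_in_def)
  ultimately have e_eq: "e = u (node h j) + (u (node h (j + 1)) - u (node h j)) * (y - node h j) / h - u y"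
    unfolding e_def interp_def by (subst hat_sum_on_element[OF \<open>h > 0\<close> j]) auto
  have step: "node h (j + 1) - node h j = h" by (simp add: node_Suc)
  have e: "\<bar>e\<bar> \<le> L * h * (y - node h j) \<and> \<bar>e\<bar> \<le> L * h * (node h (j + 1) - y)"
  proof (cases "A \<le> j \<and> j + 1 \<le> B")
    case True
    then have "{node h j..node h (j + 1)} \<subseteq> {a..b}"
      using node_le_iff[OF \<open>h > 0\<close>] AB by auto
    from linear_interpolation_error[OF _ this der lip \<open>L \<ge> 0\<close> j]
    show ?thesis unfolding step e_eq using \<open>h > 0\<close> step by simp
  next
    case False
    have zero: "u x = 0" if "x \<le> a \<or> b \<le> x" for x
      using that outside \<open>a < b\<close> by (cases "x \<in> {a..b}") auto
    have "node h (j + 1) \<le> a \<or> b \<le> node h j"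
      using False node_le_iff[OF \<open>h > 0\<close>] AB by auto
    then have "u (node h j) = 0" "u (node h (j + 1)) = 0" "u y = 0"
      using j step \<open>h > 0\<close> by (auto intro!: zero)
    then have "e = 0" unfolding e_eq by simp
    then show ?thesis using j \<open>L \<ge> 0\<close> \<open>h > 0\<close> by simp
  qed
  have Lh: "L * h \<ge> 0" using \<open>L \<ge> 0\<close> \<open>h > 0\<close> by simp
  have "i \<le> j \<or> j + 1 \<le> i" by linarith
  then have "y - node h j \<le> \<bar>y - node h i\<bar> \<or> node h (j + 1) - y \<le> \<bar>y - node h i\<bar>"
    using node_le_iff[OF \<open>h > 0\<close>, of i j] node_le_iff[OF \<open>h > 0\<close>, of "j + 1" i] j by force
  then show "\<bar>interp a b \<epsilon> h u y - u y\<bar> \<le> L * h * \<bar>y - node h i\<bar>"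
    using e mult_left_mono[OF _ Lh] unfolding e_def by (meson order_trans)
  have "y - node h j \<le> h" using j step by auto
  then show "\<bar>interp a b \<epsilon> h u y - u y\<bar> \<le> L * h * h"
    using e mult_left_mono[OF _ Lh] unfolding e_def by (meson order_trans)
qed

lemma interp_borel_measurable: "interp a b \<epsilon> h u \<in> borel_measurable borel"
proof -
  have "hat h i \<in> borel_measurable borel" for i
    unfolding hat_def by measurable
  then show ?thesis
    unfolding interp_def by (intro borel_measurable_sum borel_measurable_times) auto
qed

section \<open>Stability of the bond force\<close>

text \<open>The bond length \<open>r\<close> may not enter the Lipschitz constant. The argument \<open>r S\<^sup>2 = (r \<bar>S\<bar>) \<bar>S\<bar>\<close> of
  \<open>g\<close> is at most \<open>B L\<close>, which bounds \<open>g\<close>; and in the change of \<open>g\<close> the factor \<open>r\<close> of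
  \<open>r S\<^sup>2 - r T\<^sup>2 = (S - T) r (S + T)\<close> is absorbed by the remaining factor \<open>T\<close>, as \<open>r \<bar>T\<bar> \<le> B\<close>.\<close>

lemma bond_force_lipschitz:
  fixes g :: "real \<Rightarrow> real"
  assumes g: "\<And>p q. p \<ge> 0 \<Longrightarrow> q \<ge> 0 \<Longrightarrow> \<bar>g p - g q\<bar> \<le> K * \<bar>p - q\<bar>"
    and nonneg: "K \<ge> 0" "r \<ge> 0"
    and S: "\<bar>S\<bar> \<le> L" "r * \<bar>S\<bar> \<le> B" and T: "\<bar>T\<bar> \<le> L" "r * \<bar>T\<bar> \<le> B"
  shows "\<bar>g (r * S\<^sup>2) * S - g (r * T\<^sup>2) * T\<bar> \<le> (\<bar>g 0\<bar> + 3 * K * B * L) * \<bar>S - T\<bar>"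
proof -
  have "L \<ge> 0" "B \<ge> 0" using S nonneg by (auto intro: order_trans[OF _ S(2)])
  have "r * S\<^sup>2 = (r * \<bar>S\<bar>) * \<bar>S\<bar>" by (simp add: power2_eq_square mult.assoc)
  also have "\<dots> \<le> B * L" using S nonneg \<open>B \<ge> 0\<close> by (intro mult_mono) auto
  finally have rS: "r * S\<^sup>2 \<le> B * L" .
  have "\<bar>g (r * S\<^sup>2)\<bar> \<le> \<bar>g 0\<bar> + K * \<bar>r * S\<^sup>2 - 0\<bar>"
    using g[of "r * S\<^sup>2" 0] nonneg by simp
  also have "\<dots> \<le> \<bar>g 0\<bar> + K * (B * L)"
    using rS nonneg by (auto intro!: mult_left_mono)
  finally have *: "\<bar>g (r * S\<^sup>2)\<bar> \<le> \<bar>g 0\<bar> + K * (B * L)" .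
  have "r * S\<^sup>2 - r * T\<^sup>2 = (S - T) * (r * (S + T))"
    by (simp add: power2_eq_square algebra_simps)
  then have "\<bar>g (r * S\<^sup>2) - g (r * T\<^sup>2)\<bar> * \<bar>T\<bar> \<le> K * (\<bar>S - T\<bar> * \<bar>r * (S + T)\<bar>) * \<bar>T\<bar>"
    using g[of "r * S\<^sup>2" "r * T\<^sup>2"] nonneg by (intro mult_right_mono) (auto simp: abs_mult)
  also have "\<dots> = K * \<bar>S - T\<bar> * (\<bar>S + T\<bar> * (r * \<bar>T\<bar>))"
    using nonneg by (simp add: abs_mult)
  also have "\<dots> \<le> K * \<bar>S - T\<bar> * ((2 * L) * B)"
    using S T nonneg \<open>L \<ge> 0\<close> by (intro mult_left_mono mult_mono) auto
  finally have **: "\<bar>g (r * S\<^sup>2) - g (r * T\<^sup>2)\<bar> * \<bar>T\<bar> \<le> 2 * K * B * L * \<bar>S - T\<bar>"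
    by (simp add: ac_simps)
  have "g (r * S\<^sup>2) * S - g (r * T\<^sup>2) * T
      = g (r * S\<^sup>2) * (S - T) + (g (r * S\<^sup>2) - g (r * T\<^sup>2)) * T"
    by (simp add: algebra_simps)
  then have "\<bar>g (r * S\<^sup>2) * S - g (r * T\<^sup>2) * T\<bar>
      \<le> \<bar>g (r * S\<^sup>2)\<bar> * \<bar>S - T\<bar> + \<bar>g (r * S\<^sup>2) - g (r * T\<^sup>2)\<bar> * \<bar>T\<bar>"
    by (metis abs_triangle_ineq abs_mult)
  also have "\<dots> \<le> (\<bar>g 0\<bar> + K * (B * L)) * \<bar>S - T\<bar> + 2 * K * B * L * \<bar>S - T\<bar>"
    using * ** by (intro add_mono mult_right_mono) auto
  finally show ?thesis by (simp add: algebra_simps)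
qed

section \<open>Stability of the peridynamic force\<close>

text \<open>A common form of the two operators, so that the linearized one is the case of a constant \<open>g\<close>.\<close>

definition peridynamic_gradient ::
  "(real \<Rightarrow> real) \<Rightarrow> (real \<Rightarrow> real) \<Rightarrow> real \<Rightarrow> (real \<Rightarrow> real) \<Rightarrow> real \<Rightarrow> real" where
  "peridynamic_gradient J g \<epsilon> u x =
     - (2 / \<epsilon>\<^sup>2 * (LINT y:{x - \<epsilon>..x + \<epsilon>}|lebesgue.
          J (\<bar>y - x\<bar> / \<epsilon>) * g (\<bar>y - x\<bar> * (strain y x u)\<^sup>2) * strain y x u))"

lemma grad_PD_eq: "grad_PD J f = peridynamic_gradient J (nth_deriv_on {0..} 1 f)"
  by (simp add: fun_eq_iff grad_PD_def peridynamic_gradient_def)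

lemma grad_PD_lin_eq: "grad_PD_lin J f = peridynamic_gradient J (\<lambda>_. nth_deriv_on {0..} 1 f 0)"
  by (simp add: fun_eq_iff grad_PD_lin_def peridynamic_gradient_def)

lemma strain_bounds:
  assumes "\<bar>u y - u x\<bar> \<le> L * \<bar>y - x\<bar>" "\<bar>u y - u x\<bar> \<le> B" "L \<ge> 0"
  shows "\<bar>strain y x u\<bar> \<le> L" "\<bar>y - x\<bar> * \<bar>strain y x u\<bar> \<le> B"
  using assms by (cases "y = x"; simp add: strain_def abs_divide divide_le_eq mult.commute)+

lemma bond_force_measurable:
  fixes g J :: "real \<Rightarrow> real"
  assumes J: "(\<lambda>\<xi>. J \<bar>\<xi>\<bar>) \<in> borel_measurable lebesgue"
    and g: "continuous_on {0..} g" and u: "u \<in> borel_measurable borel" and "\<epsilon> > 0"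
  shows "(\<lambda>y. J (\<bar>y - x\<bar> / \<epsilon>) * g (\<bar>y - x\<bar> * (strain y x u)\<^sup>2) * strain y x u)
           \<in> borel_measurable lebesgue"
proof -
  have "(\<lambda>y. - x / \<epsilon> + (1 / \<epsilon>) * y) \<in> lebesgue \<rightarrow>\<^sub>M lebesgue"
    using lebesgue_affine_measurable[where c = "\<lambda>_::real. 1 / \<epsilon>" and t = "- x / \<epsilon>"] \<open>\<epsilon> > 0\<close>
    by simp
  from measurable_compose[OF this J]
  have J': "(\<lambda>y. J (\<bar>y - x\<bar> / \<epsilon>)) \<in> borel_measurable lebesgue"
  proof (rule measurable_cong[THEN iffD1, rotated])
    fix y
    have "- x / \<epsilon> + (1 / \<epsilon>) * y = (y - x) / \<epsilon>" by (simp add: diff_divide_distrib)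
    then show "J \<bar>- x / \<epsilon> + (1 / \<epsilon>) * y\<bar> = J (\<bar>y - x\<bar> / \<epsilon>)"
      using \<open>\<epsilon> > 0\<close> by (simp add: abs_divide)
  qed
  have s: "(\<lambda>y. strain y x u) \<in> borel_measurable borel"
    unfolding strain_def using u by measurable
  \<comment> \<open>\<open>g\<close> is controlled on the half line only; \<open>g \<circ> max 0\<close> is a continuous extension to all reals.\<close>
  have "continuous_on UNIV (\<lambda>t. g (max 0 t))"
    by (rule continuous_on_compose2[OF g]) (auto intro!: continuous_intros)
  then have gm: "(\<lambda>t. g (max 0 t)) \<in> borel_measurable borel"
    by (rule borel_measurable_continuous_onI)
  have "(\<lambda>y. \<bar>y - x\<bar> * (strain y x u)\<^sup>2) \<in> borel_measurable borel"
    using s by measurable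
  from measurable_compose[OF this gm]
  have "(\<lambda>y. g (\<bar>y - x\<bar> * (strain y x u)\<^sup>2)) \<in> borel_measurable borel"
    by (simp add: max_def)
  with s have "(\<lambda>y. g (\<bar>y - x\<bar> * (strain y x u)\<^sup>2)) \<in> borel_measurable lebesgue"
    "(\<lambda>y. strain y x u) \<in> borel_measurable lebesgue"
    by (auto intro: measurable_completion)
  with J' show ?thesis by (intro borel_measurable_times)
qed

text \<open>The hypothesis \<open>close\<close> says that the strains differ by at most \<open>\<delta>\<close>, so by \<open>bond_force_lipschitz\<close> the
  integrands differ by at most a constant times \<open>\<delta>\<close>. The factor \<open>4 / \<epsilon>\<close> is the length \<open>2 \<epsilon>\<close> of the
  horizon times \<open>2 / \<epsilon>\<^sup>2\<close>. Integrability has to be established as well, since the integral of a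
  non-integrable function is 0 by convention and the difference could not be taken under the integral.\<close>

lemma peridynamic_gradient_diff_bound:
  fixes g J :: "real \<Rightarrow> real"
  assumes J: "(\<lambda>\<xi>. J \<bar>\<xi>\<bar>) \<in> borel_measurable lebesgue"
    and J_bounds: "\<And>\<xi>. \<xi> \<in> {-1..1} \<Longrightarrow> 0 \<le> J \<bar>\<xi>\<bar> \<and> J \<bar>\<xi>\<bar> \<le> M"
    and g: "\<And>p q. p \<ge> 0 \<Longrightarrow> q \<ge> 0 \<Longrightarrow> \<bar>g p - g q\<bar> \<le> K * \<bar>p - q\<bar>" and "K \<ge> 0"
    and "\<epsilon> > 0" "L \<ge> 0" "B \<ge> 0" "\<delta> \<ge> 0"
    and u: "u \<in> borel_measurable borel" "\<And>y. \<bar>u y - u x\<bar> \<le> L * \<bar>y - x\<bar>" "\<And>y. \<bar>u y - u x\<bar> \<le> B"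
    and v: "v \<in> borel_measurable borel" "\<And>y. \<bar>v y - v x\<bar> \<le> L * \<bar>y - x\<bar>" "\<And>y. \<bar>v y - v x\<bar> \<le> B"
    and close: "\<And>y. \<bar>v y - u y\<bar> \<le> \<delta> * \<bar>y - x\<bar>"
  shows "\<bar>peridynamic_gradient J g \<epsilon> v x - peridynamic_gradient J g \<epsilon> u x\<bar>
           \<le> 4 * M * (\<bar>g 0\<bar> + 3 * K * B * L) * \<delta> / \<epsilon>"
proof -
  define G where "G = \<bar>g 0\<bar> + 3 * K * B * L"
  have "G \<ge> 0" using \<open>K \<ge> 0\<close> \<open>L \<ge> 0\<close> \<open>B \<ge> 0\<close> by (simp add: G_def)
  have "M \<ge> 0" using J_bounds[of 0] by auto
  let ?I = "{x - \<epsilon>..x + \<epsilon>}"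
  define \<Phi> where
    "\<Phi> w y = J (\<bar>y - x\<bar> / \<epsilon>) * g (\<bar>y - x\<bar> * (strain y x w)\<^sup>2) * strain y x w" for w y
  have Jb: "0 \<le> J (\<bar>y - x\<bar> / \<epsilon>) \<and> J (\<bar>y - x\<bar> / \<epsilon>) \<le> M" if "y \<in> ?I" for y
    using J_bounds[of "(y - x) / \<epsilon>"] that \<open>\<epsilon> > 0\<close> by (auto simp: abs_divide field_simps)
  have su: "\<bar>strain y x u\<bar> \<le> L" "\<bar>y - x\<bar> * \<bar>strain y x u\<bar> \<le> B"
    and sv: "\<bar>strain y x v\<bar> \<le> L" "\<bar>y - x\<bar> * \<bar>strain y x v\<bar> \<le> B" for y
    using strain_bounds u(2,3) v(2,3) \<open>L \<ge> 0\<close> by blast+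
  have "v x = u x" using close[of x] by simp
  have strain_close: "\<bar>strain y x v - strain y x u\<bar> \<le> \<delta>" for y
  proof -
    have "strain y x v - strain y x u = (v y - u y) / \<bar>y - x\<bar>"
      by (simp add: strain_def \<open>v x = u x\<close> diff_divide_distrib)
    then show ?thesis
      using close[of y] \<open>\<delta> \<ge> 0\<close> by (cases "y = x") (simp_all add: abs_divide divide_le_eq)
  qed
  have \<Phi>_diff: "\<bar>\<Phi> v y - \<Phi> u y\<bar> \<le> M * (G * \<delta>)" if "y \<in> ?I" for y
  proof -
    have "\<bar>g (\<bar>y - x\<bar> * (strain y x v)\<^sup>2) * strain y x v - g (\<bar>y - x\<bar> * (strain y x u)\<^sup>2) * strain y x u\<bar>
        \<le> G * \<bar>strain y x v - strain y x u\<bar>"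
      unfolding G_def using su[of y] sv[of y] \<open>K \<ge> 0\<close> by (intro bond_force_lipschitz g) auto
    also have "\<dots> \<le> G * \<delta>" using strain_close \<open>G \<ge> 0\<close> by (intro mult_left_mono)
    finally have "J (\<bar>y - x\<bar> / \<epsilon>) * \<bar>g (\<bar>y - x\<bar> * (strain y x v)\<^sup>2) * strain y x v
        - g (\<bar>y - x\<bar> * (strain y x u)\<^sup>2) * strain y x u\<bar> \<le> M * (G * \<delta>)"
      using Jb[OF that] \<open>M \<ge> 0\<close> by (intro mult_mono) auto
    then show ?thesis
      using Jb[OF that] by (simp add: \<Phi>_def mult.assoc right_diff_distrib[symmetric] abs_mult)
  qed
  have \<Phi>_bound: "\<bar>\<Phi> w y\<bar> \<le> M * (G * L)"
    if "y \<in> ?I" "\<bar>strain y x w\<bar> \<le> L" "\<bar>y - x\<bar> * \<bar>strain y x w\<bar> \<le> B" for w y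
  proof -
    have "\<bar>g (\<bar>y - x\<bar> * (strain y x w)\<^sup>2) * strain y x w\<bar> \<le> G * L"
      using bond_force_lipschitz[where g = g and T = 0, OF g \<open>K \<ge> 0\<close> _ that(2,3)]
        \<open>L \<ge> 0\<close> \<open>B \<ge> 0\<close> mult_left_mono[OF that(2) \<open>G \<ge> 0\<close>] by (simp add: G_def)
    then have "J (\<bar>y - x\<bar> / \<epsilon>) * \<bar>g (\<bar>y - x\<bar> * (strain y x w)\<^sup>2) * strain y x w\<bar> \<le> M * (G * L)"
      using Jb[OF that(1)] \<open>M \<ge> 0\<close> by (intro mult_mono) auto
    then show ?thesis
      using Jb[OF that(1)] by (simp add: \<Phi>_def mult.assoc abs_mult)
  qed
  have g_cont: "continuous_on {0..} g"
    using g \<open>K \<ge> 0\<close>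
    by (intro lipschitz_on_continuous_on[of K] lipschitz_onI) (auto simp: dist_real_def)
  have integrable: "set_integrable lebesgue ?I (\<Phi> w)"
    if "w \<in> borel_measurable borel" "\<And>y. \<bar>strain y x w\<bar> \<le> L" "\<And>y. \<bar>y - x\<bar> * \<bar>strain y x w\<bar> \<le> B" for w
    unfolding set_integrable_def
  proof (rule integrableI_bounded_set_indicator[where B = "M * (G * L)"])
    show "\<Phi> w \<in> borel_measurable lebesgue"
      unfolding \<Phi>_def by (rule bond_force_measurable[OF J g_cont that(1) \<open>\<epsilon> > 0\<close>])
    show "AE y in lebesgue. y \<in> ?I \<longrightarrow> norm (\<Phi> w y) \<le> M * (G * L)"
      using \<Phi>_bound that(2,3) by auto
  qed (auto simp: emeasure_lborel_Icc_eq)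
  note int_u = integrable[OF u(1) su] and int_v = integrable[OF v(1) sv]
  have const: "set_integrable lebesgue ?I (\<lambda>_. M * (G * \<delta>))"
    "(LINT y:?I|lebesgue. M * (G * \<delta>)) = 2 * \<epsilon> * (M * (G * \<delta>))"
    using \<open>\<epsilon> > 0\<close> by (auto simp: set_integrable_def set_integral_const)
  have "\<bar>(LINT y:?I|lebesgue. \<Phi> v y) - (LINT y:?I|lebesgue. \<Phi> u y)\<bar>
      = \<bar>LINT y:?I|lebesgue. \<Phi> v y - \<Phi> u y\<bar>"
    using int_u int_v by simp
  also have "\<dots> \<le> (LINT y:?I|lebesgue. \<bar>\<Phi> v y - \<Phi> u y\<bar>)"
    using set_integral_norm_bound[OF set_integral_diff(1)[OF int_v int_u]] by simp
  also have "\<dots> \<le> (LINT y:?I|lebesgue. M * (G * \<delta>))"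
    using int_u int_v const(1) \<Phi>_diff by (intro set_integral_mono set_integrable_abs set_integral_diff(1))
  finally have *: "\<bar>(LINT y:?I|lebesgue. \<Phi> v y) - (LINT y:?I|lebesgue. \<Phi> u y)\<bar> \<le> 2 * \<epsilon> * (M * (G * \<delta>))"
    unfolding const(2) .
  have "peridynamic_gradient J g \<epsilon> v x - peridynamic_gradient J g \<epsilon> u x
      = - (2 / \<epsilon>\<^sup>2 * ((LINT y:?I|lebesgue. \<Phi> v y) - (LINT y:?I|lebesgue. \<Phi> u y)))"
    unfolding peridynamic_gradient_def \<Phi>_def by (simp add: right_diff_distrib)
  then have "\<bar>peridynamic_gradient J g \<epsilon> v x - peridynamic_gradient J g \<epsilon> u x\<bar>
      = 2 / \<epsilon>\<^sup>2 * \<bar>(LINT y:?I|lebesgue. \<Phi> v y) - (LINT y:?I|lebesgue. \<Phi> u y)\<bar>"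
    by (simp only: abs_minus_cancel abs_mult) simp
  also have "\<dots> \<le> 2 / \<epsilon>\<^sup>2 * (2 * \<epsilon> * (M * (G * \<delta>)))"
    using * by (intro mult_left_mono) auto
  also have "\<dots> = 4 * M * G * \<delta> / \<epsilon>"
    using \<open>\<epsilon> > 0\<close> by (simp add: power2_eq_square)
  finally show ?thesis unfolding G_def .
qed

section \<open>Uniform bound over the nodes\<close>

text \<open>As \<open>u\<close> vanishes at the endpoints, it equals \<open>u \<circ> c\<close>, where \<open>c\<close> is the nearest-point projection
  onto \<open>{a..b}\<close>, and \<open>c\<close> is 1-Lipschitz.\<close>

lemma lipschitz_extension_by_zero:
  fixes u :: "real \<Rightarrow> real"
  assumes "a \<le> b" and lip: "\<And>x y. x \<in> {a..b} \<Longrightarrow> y \<in> {a..b} \<Longrightarrow> \<bar>u x - u y\<bar> \<le> L * \<bar>x - y\<bar>"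
    and "L \<ge> 0" and outside: "u a = 0" "u b = 0" "\<And>x. x \<notin> {a..b} \<Longrightarrow> u x = 0"
  shows "\<bar>u x - u y\<bar> \<le> L * \<bar>x - y\<bar>" and "\<bar>u x\<bar> \<le> L * (b - a)"
proof -
  define c where "c x = max a (min b x)" for x
  have c: "c x \<in> {a..b}" "u (c x) = u x" for x
  proof -
    show "c x \<in> {a..b}" using \<open>a \<le> b\<close> by (auto simp: c_def)
    consider "x < a" | "x \<in> {a..b}" | "b < x" by fastforce
    then show "u (c x) = u x" using \<open>a \<le> b\<close> outside by cases (auto simp: c_def)
  qed
  have "\<bar>u x - u y\<bar> \<le> L * \<bar>c x - c y\<bar>" using lip[OF c(1) c(1), of x y] by (simp add: c(2))
  also have "\<dots> \<le> L * \<bar>x - y\<bar>"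
    using \<open>L \<ge> 0\<close> by (intro mult_left_mono) (auto simp: c_def max_def min_def)
  finally show "\<bar>u x - u y\<bar> \<le> L * \<bar>x - y\<bar>" .
  have "\<bar>u x\<bar> \<le> L * \<bar>c x - a\<bar>"
    using lip[OF c(1), of a x] \<open>a \<le> b\<close> by (simp add: c(2) outside)
  also have "\<dots> \<le> L * (b - a)"
    using c(1)[of x] \<open>L \<ge> 0\<close> by (intro mult_left_mono) auto
  finally show "\<bar>u x\<bar> \<le> L * (b - a)" .
qed

text \<open>The constants of \<open>peridynamic_gradient_diff_bound\<close> must not depend on the mesh. Those of \<open>u\<close> come from
  bounds on its first two derivatives. The interpolant inherits them up to its error, which is uniformly
  bounded because an element is no longer than the interval it subdivides: \<open>h \<le> b - a\<close>.\<close>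

lemma peridynamic_gradient_interp_error:
  fixes a b M K :: real and g J u :: "real \<Rightarrow> real"
  assumes "a < b"
    and J: "(\<lambda>\<xi>. J \<bar>\<xi>\<bar>) \<in> borel_measurable lebesgue"
    and J_bounds: "\<And>\<xi>. \<xi> \<in> {-1..1} \<Longrightarrow> 0 \<le> J \<bar>\<xi>\<bar> \<and> J \<bar>\<xi>\<bar> \<le> M"
    and g: "\<And>p q. p \<ge> 0 \<Longrightarrow> q \<ge> 0 \<Longrightarrow> \<bar>g p - g q\<bar> \<le> K * \<bar>p - q\<bar>" and "K \<ge> 0"
    and u_C2: "Cn_on n {a..b} u" "n \<ge> 2"
    and outside: "u a = 0" "u b = 0" "\<And>x. x \<notin> {a..b} \<Longrightarrow> u x = 0"
  shows "\<exists>C. \<forall>\<epsilon> h. admissible_mesh a b \<epsilon> h \<longrightarrow>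
            (SUP i\<in>nodes_in h {a..b}.
               \<bar>peridynamic_gradient J g \<epsilon> (interp a b \<epsilon> h u) (node h i)
                 - peridynamic_gradient J g \<epsilon> u (node h i)\<bar>) \<le> C * (h / \<epsilon>)"
proof -
  obtain L1 where L1: "L1 \<ge> 0" "\<And>x. x \<in> {a..b} \<Longrightarrow> \<bar>nth_deriv_on {a..b} (Suc 0) u x\<bar> \<le> L1"
    using nth_deriv_on_bounded[OF u_C2(1), of "Suc 0"] u_C2(2) by auto
  obtain L2 where L2: "L2 \<ge> 0" "\<And>x. x \<in> {a..b} \<Longrightarrow> \<bar>nth_deriv_on {a..b} (Suc (Suc 0)) u x\<bar> \<le> L2"
    using nth_deriv_on_bounded[OF u_C2(1), of "Suc (Suc 0)"] u_C2(2) by auto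
  define u' where "u' = nth_deriv_on {a..b} (Suc 0) u"
  have der: "(u has_real_derivative u' x) (at x within {a..b})" if "x \<in> {a..b}" for x
    using nth_deriv_on_has_derivative[OF u_C2(1), of 0 x] u_C2(2) that by (simp add: u'_def)
  have u'_lip: "\<bar>u' x - u' y\<bar> \<le> L2 * \<bar>x - y\<bar>" if "x \<in> {a..b}" "y \<in> {a..b}" for x y
    unfolding u'_def
    by (rule nth_deriv_on_lipschitz[OF u_C2(1)]) (use u_C2(2) L2 that in auto)
  have "\<bar>u x - u y\<bar> \<le> L1 * \<bar>x - y\<bar>" if "x \<in> {a..b}" "y \<in> {a..b}" for x y
    using nth_deriv_on_lipschitz[OF u_C2(1), of 0 L1 x y] u_C2(2) L1(2) that by simp
  note u_lip = lipschitz_extension_by_zero[OF less_imp_le[OF \<open>a < b\<close>] this L1(1) outside]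
  have "continuous_on UNIV u"
    using u_lip(1) L1(1)
    by (intro lipschitz_on_continuous_on[of L1] lipschitz_onI) (auto simp: dist_real_def)
  then have u_meas: "u \<in> borel_measurable borel" by (rule borel_measurable_continuous_onI)
  define d where "d = b - a"
  define L where "L = L1 + L2 * d"
  define B where "B = 2 * (L1 * d + L2 * d * d)"
  have "d > 0" using \<open>a < b\<close> by (simp add: d_def)
  have "L \<ge> L1" "B \<ge> 2 * (L1 * d)" using L1(1) L2(1) \<open>d > 0\<close> by (auto simp: L_def B_def)
  then have LB: "L \<ge> 0" "B \<ge> 0" using L1(1) \<open>d > 0\<close> by (auto intro: order_trans[rotated])
  define C where "C = 4 * M * (\<bar>g 0\<bar> + 3 * K * B * L) * L2"
  have "(SUP i\<in>nodes_in h {a..b}. \<bar>peridynamic_gradient J g \<epsilon> (interp a b \<epsilon> h u) (node h i)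
                 - peridynamic_gradient J g \<epsilon> u (node h i)\<bar>) \<le> C * (h / \<epsilon>)"
    if mesh: "admissible_mesh a b \<epsilon> h" for \<epsilon> h
  proof (rule cSUP_least)
    have pos: "h > 0" "\<epsilon> > 0" using mesh by (auto simp: admissible_mesh_def)
    obtain A' B' where AB: "a = node h A'" "b = node h B'"
      using meshed_interval_endpoints[of h a b] mesh \<open>a < b\<close> by (auto simp: admissible_mesh_def)
    then have "A' \<in> nodes_in h {a..b}" using \<open>a < b\<close> by (simp add: nodes_in_def)
    then show "nodes_in h {a..b} \<noteq> {}" by blast
    have "A' + 1 \<le> B'" using node_le_iff[OF pos(1), of B' A'] AB \<open>a < b\<close> by linarith
    then have "h \<le> d" using node_le_iff[OF pos(1), of "A' + 1" B'] AB by (simp add: node_Suc d_def)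
    fix i assume "i \<in> nodes_in h {a..b}"
    define x where "x = node h i"
    define v where "v = interp a b \<epsilon> h u"
    note err = interp_error[OF mesh \<open>a < b\<close> der u'_lip L2(1) outside, folded v_def]
    have close: "\<bar>v y - u y\<bar> \<le> L2 * h * \<bar>y - x\<bar>" for y using err(1) by (simp add: x_def)
    have "v x = u x" using close[of x] by simp
    have "L2 * h \<le> L2 * d" using \<open>h \<le> d\<close> L2(1) by (rule mult_left_mono)
    have v_lip: "\<bar>v y - v x\<bar> \<le> L * \<bar>y - x\<bar>" for y
    proof -
      have "\<bar>v y - v x\<bar> \<le> L1 * \<bar>y - x\<bar> + L2 * h * \<bar>y - x\<bar>"
        using u_lip(1)[of y x] close[of y] \<open>v x = u x\<close> by linarith
      also have "\<dots> \<le> L * \<bar>y - x\<bar>"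
        using mult_right_mono[OF \<open>L2 * h \<le> L2 * d\<close>, of "\<bar>y - x\<bar>"] by (simp add: L_def algebra_simps)
      finally show ?thesis .
    qed
    have "L2 * h * h \<le> L2 * d * d" using \<open>h \<le> d\<close> pos L2(1) by (intro mult_mono) auto
    then have v_bound: "\<bar>v y - v x\<bar> \<le> B" for y
      using u_lip(2)[of y] u_lip(2)[of x] err(2)[of y] \<open>v x = u x\<close> L2(1) \<open>d > 0\<close>
      unfolding B_def d_def by (smt (verit) mult_nonneg_nonneg)
    have "\<bar>u y - u x\<bar> \<le> L * \<bar>y - x\<bar>" for y
      using u_lip(1)[of y x] mult_right_mono[OF \<open>L \<ge> L1\<close>, of "\<bar>y - x\<bar>"] by simp
    moreover have "\<bar>u y - u x\<bar> \<le> B" for y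
      using u_lip(2)[of y] u_lip(2)[of x] \<open>B \<ge> 2 * (L1 * d)\<close> unfolding d_def by linarith
    ultimately have "\<bar>peridynamic_gradient J g \<epsilon> v x - peridynamic_gradient J g \<epsilon> u x\<bar>
        \<le> 4 * M * (\<bar>g 0\<bar> + 3 * K * B * L) * (L2 * h) / \<epsilon>"
      using pos L2(1) v_lip v_bound close u_meas
      by (intro peridynamic_gradient_diff_bound J J_bounds g \<open>K \<ge> 0\<close> LB)
         (auto simp: v_def interp_borel_measurable)
    then show "\<bar>peridynamic_gradient J g \<epsilon> (interp a b \<epsilon> h u) (node h i)
                 - peridynamic_gradient J g \<epsilon> u (node h i)\<bar> \<le> C * (h / \<epsilon>)"
      by (simp add: C_def x_def v_def mult.assoc)
  qed
  then show ?thesis by blast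
qed

theorem proposition2:
  fixes a b M f_inf :: real and f J u :: "real \<Rightarrow> real"
  assumes D: "a < b"
    and f_pos: "\<And>r. r > 0 \<Longrightarrow> f r > 0"
    and f_smooth: "smooth_on {0..} f"
    and f_concave: "concave_on {0..} f"
    and f_zero: "((\<lambda>r. f r / r) \<longlongrightarrow> nth_deriv_on {0..} 1 f 0) (at_right 0)"
    and f_infinity: "(f \<longlongrightarrow> f_inf) at_top"
    and f_bounded: "\<And>k. k \<in> {2, 3, 4} \<Longrightarrow> bounded (nth_deriv_on {0..} k f ` {0<..})"
    and J_measurable: "(\<lambda>\<xi>. J \<bar>\<xi>\<bar>) \<in> borel_measurable lebesgue"
    and J_outside: "\<And>\<xi>. \<xi> \<notin> {-1..1} \<Longrightarrow> J \<bar>\<xi>\<bar> = 0"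
    and J_bounds: "\<And>\<xi>. \<xi> \<in> {-1..1} \<Longrightarrow> 0 \<le> J \<bar>\<xi>\<bar> \<and> J \<bar>\<xi>\<bar> \<le> M"
    and u_C3: "Cn_on 3 {a..b} u"
    and u_xxx_bounded: "bounded (nth_deriv_on {a..b} 3 u ` {a..b})"
    and u_boundary: "u a = 0" "u b = 0"
    and u_outside: "\<And>x. x \<notin> {a..b} \<Longrightarrow> u x = 0"
  shows "(\<exists>C. \<forall>\<epsilon> h. admissible_mesh a b \<epsilon> h \<longrightarrow>
            (SUP i\<in>nodes_in h {a..b}.
               \<bar>grad_PD_lin J f \<epsilon> (interp a b \<epsilon> h u) (node h i)
                 - grad_PD_lin J f \<epsilon> u (node h i)\<bar>) \<le> C * (h / \<epsilon>))
       \<and> (\<exists>C. \<forall>\<epsilon> h. admissible_mesh a b \<epsilon> h \<longrightarrow>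
            (SUP i\<in>nodes_in h {a..b}.
               \<bar>grad_PD J f \<epsilon> (interp a b \<epsilon> h u) (node h i)
                 - grad_PD J f \<epsilon> u (node h i)\<bar>) \<le> C * (h / \<epsilon>))"
proof -
  let ?g = "nth_deriv_on {0..} 1 f"
  have "bounded (nth_deriv_on {0..} 2 f ` {0<..})" by (rule f_bounded) simp
  then obtain K where K: "K > 0" "\<forall>r\<in>{0<..}. \<bar>nth_deriv_on {0..} 2 f r\<bar> \<le> K"
    by (auto simp: bounded_pos)
  \<comment> \<open>The bound on \<open>f''\<close> leaves out the point 0, where the one-sided second derivative is some finite number.\<close>
  define K0 where "K0 = max K \<bar>nth_deriv_on {0..} 2 f 0\<bar>"
  have "\<bar>nth_deriv_on {0..} (Suc 1) f r\<bar> \<le> K0" if "r \<in> {0..}" for r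
    using K(2) that unfolding K0_def Suc_1 by (cases "r = 0") (auto intro: max.coboundedI1)
  then have g_lip: "\<bar>?g p - ?g q\<bar> \<le> K0 * \<bar>p - q\<bar>" if "p \<ge> 0" "q \<ge> 0" for p q
    using that f_smooth by (intro nth_deriv_on_lipschitz[where n = 2]) (auto simp: smooth_on_def)
  have "K0 \<ge> 0" using K(1) by (simp add: K0_def)
  show ?thesis
    unfolding grad_PD_eq grad_PD_lin_eq
    using peridynamic_gradient_interp_error[where g = ?g, OF D J_measurable J_bounds
        g_lip \<open>K0 \<ge> 0\<close> u_C3 _ u_boundary u_outside]
      peridynamic_gradient_interp_error[where g = "\<lambda>_. ?g 0" and K = 0, OF D J_measurable
        J_bounds _ _ u_C3 _ u_boundary u_outside]
    by simp
qed

end
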